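(* For $n\ge 1$ and $0<r\le 1$ let $t_n^a(r)$ be the supremum of $\|T^{-1}\|$ over all $n\times n$ analytic (i.e. lower triangular) Toeplitz matrices $T$ with $\|T\|\le 1$ and all eigenvalues of modulus at least $r$, and let $c_n(r)$ be the supremum of $\|T^{-1}\|$ over all complex $n\times n$ matrices $T$ with $\|T\|\le 1$ and all eigenvalues of modulus at least $r$. Then: 1) For all $r\in(0,1)$ and all $n\ge 1$, $$\frac12\le r^n t_n^a(r)\le r^n c_n(r)=1.$$ 2) For every $n\ge 1$, $$\lim_{r\to 0^+} r^n t_n^a(r)=\lim_{r\to 1^-} r^n t_n^a(r)=1,$$ and for every $0<r\le 1$, $$\lim_{n\to\infty} r^n t_n^a(r)=1.$$
   Context: Matrices are complex and act on $\mathbb{C}^n$ with its standard Euclidean (Hilbert space) structure; $\|\cdot\|$ is the corresponding operator norm. For an $n\times n$ matrix $T$ with spectrum $\sigma(T)=\{\lambda_1,\dots,\lambda_n\}$ put $r_{\min}(T)=\min_{1\le i\le n}|\lambda_i|$. For a family $\mathcal{F}$ of $n\times n$ matrices and $0<r\le 1$ put $$c_n(\mathcal{F},r)=\sup\{\|T^{-1}\| : T\in\mathcal{F},\ \|T\|\le 1,\ r_{\min}(T)\ge r\}$$ (the condition $r_{\min}(T)\ge r>0$ makes $T$ invertible). An $n\times n$ matrix $T=(T_{ij})_{0\le i,j\le n-1}$ is an analytic Toeplitz matrix if there are complex numbers $a_0,\dots,a_{n-1}$ with $T_{ij}=a_{i-j}$ for $i\ge j$ and $T_{ij}=0$ for $i<j$;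 the set of these is denoted $\mathcal{T}_n^a$. Then $t_n^a(r)=c_n(\mathcal{T}_n^a,r)$, and $c_n(r)=c_n(\mathcal{F},r)$ with $\mathcal{F}$ the set of all complex $n\times n$ matrices. *)

theory Defs
  imports
    "HOL-Analysis.L2_Norm"
    "HOL-Library.Extended_Real"
    "Jordan_Normal_Form.Gauss_Jordan_Elimination"
    "Jordan_Normal_Form.Spectral_Radius"
begin

definition vec_norm :: "complex vec \<Rightarrow> real" where
  "vec_norm v = L2_set (\<lambda>i. cmod (v $ i)) {..<dim_vec v}"

definition op_norm :: "complex mat \<Rightarrow> real" where
  "op_norm A = (SUP v\<in>{v \<in> carrier_vec (dim_col A). vec_norm v \<le> 1}. vec_norm (A *\<^sub>v v))"

text \<open>As \<open>Min\<close> is unspecified on the empty set, \<open>r_min\<close> is meaningful only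
  for square matrices of dimension at least 1.\<close>

definition r_min :: "complex mat \<Rightarrow> real" where
  "r_min T = Min (cmod ` spectrum T)"

text \<open>The supremum is taken in the extended reals, so that a finite value of \<open>c_fam F r\<close>
  says that the norms of the inverses are bounded. The size \<open>n\<close> is carried by the
  family \<open>F\<close>. For \<open>n \<ge> 1\<close> and \<open>r > 0\<close> every \<open>T\<close> in the index set is invertible,
  so \<open>mat_inverse T\<close> is of the form \<open>Some _\<close>.\<close>

definition c_fam :: "complex mat set \<Rightarrow> real \<Rightarrow> ereal" where
  "c_fam F r = (SUP T\<in>{T \<in> F. op_norm T \<le> 1 \<and> r_min T \<ge> r}. ereal (op_norm (the (mat_inverse T))))"

definition analytic_toeplitz :: "nat \<Rightarrow> complex mat set" where
  "analytic_toeplitz n = {T \<in> carrier_mat n n.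
     \<exists>a :: nat \<Rightarrow> complex. \<forall>i<n. \<forall>j<n. T $$ (i, j) = (if j \<le> i then a (i - j) else 0)}"

definition t_a :: "nat \<Rightarrow> real \<Rightarrow> ereal" where
  "t_a n r = c_fam (analytic_toeplitz n) r"

definition c_all :: "nat \<Rightarrow> real \<Rightarrow> ereal" where
  "c_all n r = c_fam (carrier_mat n n) r"

end

theory Submission
  imports Defs
begin

text \<open>In fact \<open>r\<^sup>n t_a n r = r\<^sup>n c_all n r = 1\<close> for all \<open>n \<ge> 1\<close> and \<open>0 < r \<le> 1\<close>, so all the limits
  are limits of eventually constant functions.

  For the upper bound, let \<open>T\<close> be a contraction, \<open>v\<close> a unit vector and \<open>T v = s w\<close> with \<open>w\<close> a unit
  vector and \<open>s > 0\<close>. The matrix \<open>B = T + w (v\<^sup>* - w\<^sup>* T)\<close> maps \<open>v\<close> to \<open>w\<close> and acts on the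
  orthogonal complement of \<open>v\<close> as \<open>(1 - w w\<^sup>*) T\<close>; hence it is a contraction and all its
  eigenvalues lie in the unit disc. As \<open>B = T E\<close> for a rank-one perturbation \<open>E\<close> of the identity
  with determinant \<open>1 / s\<close>, this gives \<open>r\<^sup>n \<le> |det T| \<le> s\<close>.

  The bound is attained at \<open>T = (r - S) (1 - r S)\<^sup>-\<^sup>1\<close>, where \<open>S\<close> is the nilpotent shift: the
  singular values of this contraction are \<open>1, \<dots>, 1, r\<^sup>n\<close>.\<close>

section \<open>Euclidean norm of complex vectors\<close>

lemma vec_norm_nonneg [simp]: "0 \<le> vec_norm v"
  by (simp add: vec_norm_def L2_set_nonneg)

lemma vec_norm_power2: "(vec_norm v)\<^sup>2 = (\<Sum>i<dim_vec v. (cmod (v $ i))\<^sup>2)"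
  by (simp add: vec_norm_def L2_set_def sum_nonneg)

lemma cscalar_prod_self: "v \<bullet>c v = complex_of_real ((vec_norm v)\<^sup>2)"
  unfolding vec_norm_power2 of_real_sum complex_norm_square
  by (simp add: scalar_prod_def lessThan_atLeast0)

lemma vec_norm_smult: "vec_norm (k \<cdot>\<^sub>v v) = cmod k * vec_norm v"
  by (auto simp: vec_norm_def norm_mult L2_set_right_distrib intro!: L2_set_cong)

lemma vec_norm_eq_0_iff: "v \<in> carrier_vec n \<Longrightarrow> vec_norm v = 0 \<longleftrightarrow> v = 0\<^sub>v n"
  by (auto simp: vec_norm_def L2_set_eq_0_iff)

lemma vec_norm_power2_add_smult:
  assumes "a \<in> carrier_vec n" "w \<in> carrier_vec n"
  shows "(vec_norm (a + k \<cdot>\<^sub>v w))\<^sup>2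
    = (vec_norm a)\<^sup>2 + 2 * Re (cnj k * (a \<bullet>c w)) + (cmod k)\<^sup>2 * (vec_norm w)\<^sup>2"
proof -
  have "(cmod (x + k * y))\<^sup>2 = (cmod x)\<^sup>2 + 2 * Re (cnj k * (x * cnj y)) + (cmod k)\<^sup>2 * (cmod y)\<^sup>2" for x y
    unfolding cmod_power2 by (simp add: power2_eq_square algebra_simps)
  with assms show ?thesis
    by (simp add: vec_norm_power2 scalar_prod_def lessThan_atLeast0 sum.distrib sum_distrib_left)
qed

section \<open>Operator norm\<close>

text \<open>A real-valued \<open>SUP\<close> obeys its upper-bound law only on sets bounded above.
  On the unit ball every coordinate has modulus at most 1, so the sum of the moduli of all entries
  is a crude bound.\<close>

lemma bdd_above_op_norm:
  "bdd_above ((\<lambda>v. vec_norm (A *\<^sub>v v)) ` {v \<in> carrier_vec (dim_col A). vec_norm v \<le> 1})"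
proof (rule bdd_aboveI2)
  fix v assume "v \<in> {v \<in> carrier_vec (dim_col A). vec_norm v \<le> 1}"
  then have v: "dim_vec v = dim_col A" "vec_norm v \<le> 1" by auto
  have le1: "cmod (v $ j) \<le> 1" if "j < dim_col A" for j
    using member_le_L2_set[of "{..<dim_vec v}" j "\<lambda>i. cmod (v $ i)"] v that
    by (simp add: vec_norm_def)
  have "vec_norm (A *\<^sub>v v) \<le> (\<Sum>i<dim_row A. cmod ((A *\<^sub>v v) $ i))"
    unfolding vec_norm_def dim_mult_mat_vec by (rule L2_set_le_sum) simp
  also have "\<dots> \<le> (\<Sum>i<dim_row A. \<Sum>j<dim_col A. cmod (A $$ (i, j)))"
  proof (rule sum_mono)
    fix i assume "i \<in> {..<dim_row A}"
    then have "cmod ((A *\<^sub>v v) $ i) = cmod (\<Sum>j<dim_col A. A $$ (i, j) * v $ j)"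
      using v by (simp add: scalar_prod_def lessThan_atLeast0)
    also have "\<dots> \<le> (\<Sum>j<dim_col A. cmod (A $$ (i, j)))"
      by (rule sum_norm_le) (auto simp: norm_mult intro: mult_left_le le1)
    finally show "cmod ((A *\<^sub>v v) $ i) \<le> (\<Sum>j<dim_col A. cmod (A $$ (i, j)))" .
  qed
  finally show "vec_norm (A *\<^sub>v v) \<le> (\<Sum>i<dim_row A. \<Sum>j<dim_col A. cmod (A $$ (i, j)))" .
qed

lemma vec_norm_mult_le:
  assumes "A \<in> carrier_mat m n" "v \<in> carrier_vec n"
  shows "vec_norm (A *\<^sub>v v) \<le> op_norm A * vec_norm v"
proof (cases "vec_norm v = 0")
  case True
  then have "v = 0\<^sub>v n" using assms vec_norm_eq_0_iff by blast
  then have "A *\<^sub>v v = 0\<^sub>v m" using assms(1) by auto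
  then show ?thesis using True vec_norm_eq_0_iff[of "0\<^sub>v m" m] by simp
next
  case False
  define u where "u = complex_of_real (1 / vec_norm v) \<cdot>\<^sub>v v"
  have u: "u \<in> carrier_vec n" "vec_norm u = 1"
    using assms False unfolding u_def by (auto simp: vec_norm_smult norm_divide)
  have "vec_norm (A *\<^sub>v u) \<le> op_norm A"
    unfolding op_norm_def using assms u
    by (intro cSUP_upper[OF _ bdd_above_op_norm]) auto
  also have "A *\<^sub>v u = complex_of_real (1 / vec_norm v) \<cdot>\<^sub>v (A *\<^sub>v v)"
    unfolding u_def using assms by (intro mult_mat_vec) auto
  finally show ?thesis
    using False vec_norm_nonneg[of v]
    by (simp add: vec_norm_smult norm_divide pos_divide_le_eq less_le)
qed

lemma op_norm_le:
  assumes "A \<in> carrier_mat m n" "0 \<le> K"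
    and "\<And>v. v \<in> carrier_vec n \<Longrightarrow> vec_norm (A *\<^sub>v v) \<le> K * vec_norm v"
  shows "op_norm A \<le> K"
  unfolding op_norm_def
proof (rule cSUP_least)
  have "0\<^sub>v n \<in> {v \<in> carrier_vec (dim_col A). vec_norm v \<le> 1}"
    using assms(1) vec_norm_eq_0_iff[of "0\<^sub>v n" n] by simp
  then show "{v \<in> carrier_vec (dim_col A). vec_norm v \<le> 1} \<noteq> {}" by blast
next
  fix v assume "v \<in> {v \<in> carrier_vec (dim_col A). vec_norm v \<le> 1}"
  then have "v \<in> carrier_vec n" "vec_norm v \<le> 1" using assms(1) by auto
  then show "vec_norm (A *\<^sub>v v) \<le> K"
    using assms(3)[of v] mult_left_le[OF _ assms(2), of "vec_norm v"] by simp
qed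

section \<open>Determinants\<close>

text \<open>Sylvester's determinant identity. Both products of the block matrices \<open>?M\<close>
  and \<open>?U\<close> are block lower triangular, and their determinants agree because
  determinants commute.\<close>

lemma det_one_plus_mult_commute:
  fixes A :: "'a :: idom mat"
  assumes A: "A \<in> carrier_mat n m" and B: "B \<in> carrier_mat m n"
  shows "det (1\<^sub>m n + A * B) = det (1\<^sub>m m + B * A)"
proof -
  let ?M = "four_block_mat (1\<^sub>m n) (- A) B (1\<^sub>m m)"
  let ?U = "four_block_mat (1\<^sub>m n) A (0\<^sub>m m n) (1\<^sub>m m)"
  have M: "?M \<in> carrier_mat (n + m) (n + m)" and U: "?U \<in> carrier_mat (n + m) (n + m)"
    using A B by auto
  have AB: "A * B \<in> carrier_mat n n" and BA: "B * A \<in> carrier_mat m m"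
    using A B by auto
  have "?M * ?U = four_block_mat (1\<^sub>m n) (0\<^sub>m n m) B (1\<^sub>m m + B * A)"
    using A B AB BA
    by (subst mult_four_block_mat[of _ n n _ m _ m _ _ n _ m])
      (auto simp: comm_add_mat[of _ m m])
  moreover have "?U * ?M = four_block_mat (1\<^sub>m n + A * B) (0\<^sub>m n m) B (1\<^sub>m m)"
    using A B AB BA
    by (subst mult_four_block_mat[of _ n n _ m _ m _ _ n _ m]) auto
  ultimately have "det ?M * det ?U = det (1\<^sub>m m + B * A)"
    and "det ?U * det ?M = det (1\<^sub>m n + A * B)"
    using A B AB BA
    by (auto simp: det_mult[OF M U, symmetric] det_mult[OF U M, symmetric]
        det_four_block_mat_upper_right_zero[of _ n _ m])
  then show ?thesis by (simp add: mult.commute)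
qed

text \<open>The matrix determinant lemma: an outer product is a column times a row, so Sylvester's
  identity reduces the determinant to size 1.\<close>

lemma det_one_plus_outer_prod:
  fixes v p :: "'a :: idom vec"
  assumes "v \<in> carrier_vec n" "p \<in> carrier_vec n"
  shows "det (1\<^sub>m n + mat n n (\<lambda>(i, j). v $ i * p $ j)) = 1 + p \<bullet> v"
proof -
  let ?C = "mat n 1 (\<lambda>(i, j). v $ i)" and ?R = "mat 1 n (\<lambda>(i, j). p $ j)"
  have "mat n n (\<lambda>(i, j). v $ i * p $ j) = ?C * ?R"
    by (rule eq_matI) (auto simp: scalar_prod_def)
  moreover have "?R * ?C = mat 1 1 (\<lambda>_. p \<bullet> v)"
    using assms by (intro eq_matI) (auto simp: scalar_prod_def)
  moreover have "det (1\<^sub>m 1 + mat 1 1 (\<lambda>_. p \<bullet> v)) = 1 + p \<bullet> v"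
    by (subst det_single) auto
  ultimately show ?thesis
    using det_one_plus_mult_commute[of ?C n 1 ?R] by simp
qed

text \<open>The characteristic polynomial splits over the complex numbers, and its value at 0 is
  \<open>det (- A)\<close>; taking moduli removes the sign. The list \<open>as\<close> records
  algebraic multiplicities.\<close>

lemma cmod_det_eq_prod_eigenvalues:
  fixes A :: "complex mat"
  assumes A: "A \<in> carrier_mat n n"
  obtains as where "cmod (det A) = (\<Prod>a\<leftarrow>as. cmod a)" "length as = n"
    "\<And>a. a \<in> set as \<Longrightarrow> eigenvalue A a"
proof -
  obtain as where as: "char_poly A = (\<Prod>a\<leftarrow>as. [:- a, 1:])" "length as = n"
    using char_poly_factorized[OF A] by blast
  have "poly (char_poly A) 0 = det (- A)"
    unfolding char_poly_def
    by (rule poly_det_cong[of _ n]) (use A in \<open>auto simp: char_poly_matrix_def\<close>)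
  also have "- A = (-1) \<cdot>\<^sub>m A"
    by (rule eq_matI) auto
  also have "det \<dots> = (-1) ^ n * det A"
    using A by simp
  finally have "cmod (det A) = cmod (poly (char_poly A) 0)"
    by (simp add: norm_mult norm_power)
  also have "\<dots> = (\<Prod>a\<leftarrow>as. cmod a)"
    unfolding as by (induction as) (auto simp: norm_mult)
  finally have "cmod (det A) = (\<Prod>a\<leftarrow>as. cmod a)" .
  moreover have "eigenvalue A a" if "a \<in> set as" for a
    using that unfolding eigenvalue_root_char_poly[OF A] as poly_prod_list
    by (auto simp: prod_list_zero_iff image_iff intro!: bexI[of _ a])
  ultimately show thesis using as(2) that by blast
qed

section \<open>Contractions\<close>

text \<open>No eigenvector is lengthened, so every eigenvalue lies in the closed unit disc, and so
  does their product.\<close>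

lemma cmod_det_le_1_if_contraction:
  assumes B: "B \<in> carrier_mat n n"
    and contr: "\<And>x. x \<in> carrier_vec n \<Longrightarrow> vec_norm (B *\<^sub>v x) \<le> vec_norm x"
  shows "cmod (det B) \<le> 1"
proof -
  obtain as where as: "cmod (det B) = (\<Prod>a\<leftarrow>as. cmod a)" "\<And>a. a \<in> set as \<Longrightarrow> eigenvalue B a"
    using cmod_det_eq_prod_eigenvalues[OF B] by metis
  have "cmod a \<le> 1" if ev: "eigenvalue B a" for a
  proof -
    obtain x where x: "x \<in> carrier_vec n" "x \<noteq> 0\<^sub>v n" "B *\<^sub>v x = a \<cdot>\<^sub>v x"
      using ev B by (auto simp: eigenvalue_def eigenvector_def)
    then have "cmod a * vec_norm x \<le> vec_norm x" "0 < vec_norm x"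
      using contr[of x] vec_norm_eq_0_iff[of x n] vec_norm_nonneg[of x]
      by (auto simp: vec_norm_smult less_le)
    then show ?thesis by (simp add: mult_le_cancel_right1)
  qed
  then have "\<forall>a\<in>set as. cmod a \<le> 1" using as(2) by blast
  then have "(\<Prod>a\<leftarrow>as. cmod a) \<le> 1"
    by (induction as) (auto intro!: mult_le_one prod_list_nonneg)
  then show ?thesis using as(1) by simp
qed

lemma cmod_det_le_norm_unit_image:
  assumes T: "T \<in> carrier_mat n n"
    and contr: "\<And>x. x \<in> carrier_vec n \<Longrightarrow> vec_norm (T *\<^sub>v x) \<le> vec_norm x"
    and v: "v \<in> carrier_vec n" "vec_norm v = 1" and s: "0 < vec_norm (T *\<^sub>v v)"
  shows "cmod (det T) \<le> vec_norm (T *\<^sub>v v)"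
proof -
  define s where "s = vec_norm (T *\<^sub>v v)"
  have s: "0 < s" using assms(5) unfolding s_def .
  define w where "w = complex_of_real (1 / s) \<cdot>\<^sub>v (T *\<^sub>v v)"
  have w: "w \<in> carrier_vec n" "vec_norm w = 1"
    using s T v unfolding w_def by (auto simp: vec_norm_smult norm_divide s_def)
  have Tv: "T *\<^sub>v v = complex_of_real s \<cdot>\<^sub>v w"
    using s unfolding w_def by (simp add: smult_smult_assoc)
  \<comment> \<open>With \<open>E\<close> the identity plus the outer product of \<open>v\<close>
    and \<open>p\<close>, this choice makes \<open>T * E\<close> the matrix \<open>B\<close> of the
    introduction: since \<open>T v = s w\<close>, the factor \<open>1 / s\<close> cancels.\<close>
  define p where "p = complex_of_real (1 / s) \<cdot>\<^sub>v (conjugate v - T\<^sup>T *\<^sub>v conjugate w)"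
  have p: "p \<in> carrier_vec n" using v w T unfolding p_def by auto
  have px: "p \<bullet> x = (x \<bullet>c v - (T *\<^sub>v x) \<bullet>c w) / s" if x: "x \<in> carrier_vec n" for x
  proof -
    have "(T\<^sup>T *\<^sub>v conjugate w) \<bullet> x = conjugate w \<bullet> (T *\<^sub>v x)"
      using T w x by (intro transpose_vec_mult_scalar) auto
    also have "\<dots> = (T *\<^sub>v x) \<bullet>c w" using T w x by (intro comm_scalar_prod[of _ n]) auto
    finally have 1: "(T\<^sup>T *\<^sub>v conjugate w) \<bullet> x = (T *\<^sub>v x) \<bullet>c w" .
    have 2: "conjugate v \<bullet> x = x \<bullet>c v" using v x by (intro comm_scalar_prod[of _ n]) auto
    have "p \<bullet> x = complex_of_real (1 / s) * ((conjugate v - T\<^sup>T *\<^sub>v conjugate w) \<bullet> x)"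
      unfolding p_def using T v w x by (intro smult_scalar_prod_distrib) auto
    also have "(conjugate v - T\<^sup>T *\<^sub>v conjugate w) \<bullet> x = x \<bullet>c v - (T *\<^sub>v x) \<bullet>c w"
      unfolding 1[symmetric] 2[symmetric]
      using T v w x by (intro minus_scalar_prod_distrib) auto
    finally show ?thesis by simp
  qed
  define E where "E = 1\<^sub>m n + mat n n (\<lambda>(i, j). v $ i * p $ j)"
  have E: "E \<in> carrier_mat n n" unfolding E_def by simp
  \<comment> \<open>This fixes \<open>p \<bullet> v\<close>, and the determinant of \<open>E\<close>
    is \<open>1 + p \<bullet> v\<close>.\<close>
  have "(T *\<^sub>v v) \<bullet>c w = s"
    unfolding Tv using w by (simp add: cscalar_prod_self)
  then have "p \<bullet> v = 1 / s - 1" using px[OF v(1)] v(2) s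
    by (simp add: cscalar_prod_self field_simps)
  then have detE: "det E = 1 / s"
    using det_one_plus_outer_prod[OF v(1) p] unfolding E_def by simp
  have Ex: "E *\<^sub>v x = x + (p \<bullet> x) \<cdot>\<^sub>v v" if x: "x \<in> carrier_vec n" for x
  proof -
    have "mat n n (\<lambda>(i, j). v $ i * p $ j) *\<^sub>v x = (p \<bullet> x) \<cdot>\<^sub>v v"
      using x v p by (intro eq_vecI) (auto simp: scalar_prod_def sum_distrib_left ac_simps)
    then show ?thesis unfolding E_def using x
      by (subst add_mult_distrib_mat_vec[of _ n n]) auto
  qed
  have "vec_norm ((T * E) *\<^sub>v x) \<le> vec_norm x" if x: "x \<in> carrier_vec n" for x
  proof -
    \<comment> \<open>Split \<open>x = y + c v\<close> with \<open>y\<close> orthogonal to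
      \<open>v\<close>. The goal is \<open>T E x = (T y - d w) + c w\<close>, where
      \<open>d w\<close> is the component of \<open>T y\<close> along \<open>w\<close>.\<close>
    define c where "c = x \<bullet>c v"
    define y where "y = x + (- c) \<cdot>\<^sub>v v"
    have y: "y \<in> carrier_vec n" using x v unfolding y_def by auto
    define d where "d = (T *\<^sub>v y) \<bullet>c w"
    have xy: "x = y + c \<cdot>\<^sub>v v"
      using x v unfolding y_def by (intro eq_vecI) auto
    have Ty: "T *\<^sub>v y \<in> carrier_vec n" using T y by auto
    have Tx: "T *\<^sub>v x = T *\<^sub>v y + (c * s) \<cdot>\<^sub>v w"
      using T y v w unfolding xy
      by (simp add: mult_add_distrib_mat_vec[of _ n n] mult_mat_vec[of _ n n] Tv smult_smult_assoc)
    have "(T *\<^sub>v x) \<bullet>c w = d + c * s"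
      unfolding Tx d_def using Ty w
      by (simp add: add_scalar_prod_distrib[of _ n] cscalar_prod_self)
    then have "(p \<bullet> x) * s = c - d - c * s"
      using px[OF x] s by (simp add: c_def)
    then have "(T * E) *\<^sub>v x = T *\<^sub>v y + (c * s) \<cdot>\<^sub>v w + (c - d - c * s) \<cdot>\<^sub>v w"
      using T E x v w
      by (simp add: assoc_mult_mat_vec[of _ n n _ n] Ex mult_add_distrib_mat_vec[of _ n n]
          mult_mat_vec[of _ n n] Tv smult_smult_assoc Tx[symmetric])
    also have "\<dots> = T *\<^sub>v y + (c - d) \<cdot>\<^sub>v w"
      using Ty w by (intro eq_vecI) (auto simp: algebra_simps)
    finally have "(vec_norm ((T * E) *\<^sub>v x))\<^sup>2
        = (vec_norm (T *\<^sub>v y))\<^sup>2 + 2 * Re (cnj (c - d) * d) + (cmod (c - d))\<^sup>2"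
      using vec_norm_power2_add_smult[OF Ty w(1)] w(2) by (simp add: d_def algebra_simps)
    \<comment> \<open>Pythagoras in disguise: \<open>T y - d w\<close> is orthogonal to
      \<open>w\<close> and has squared norm \<open>|T y|\<^sup>2 - |d|\<^sup>2\<close>.\<close>
    also have "\<dots> = (vec_norm (T *\<^sub>v y))\<^sup>2 + (cmod c)\<^sup>2 - (cmod d)\<^sup>2"
      unfolding cmod_power2 by (simp add: power2_eq_square algebra_simps)
    also have "\<dots> \<le> (vec_norm y)\<^sup>2 + (cmod c)\<^sup>2"
      using power_mono[OF contr[OF y], of 2] by (simp add: add.commute add_increasing2 diff_le_eq)
    also have "(vec_norm y)\<^sup>2 = (vec_norm x)\<^sup>2 - (cmod c)\<^sup>2"
      using vec_norm_power2_add_smult[OF x v(1), of "- c"] v(2)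
      unfolding y_def c_def[symmetric] cmod_power2
      by (simp add: power2_eq_square algebra_simps)
    finally show ?thesis by (simp add: power2_le_iff_abs_le abs_le_iff)
  qed
  then have "cmod (det (T * E)) \<le> 1"
    using T E by (intro cmod_det_le_1_if_contraction[of _ n]) auto
  then show ?thesis
    using s unfolding det_mult[OF T E] detE s_def[symmetric]
    by (simp add: norm_mult norm_divide)
qed

text \<open>Rescaling of the bound for unit vectors; a nonzero determinant ensures
  \<open>T v \<noteq> 0\<close>. With \<open>v\<close> the preimage of a given vector, this bounds
  the inverse.\<close>

lemma cmod_det_mult_vec_norm_le:
  assumes T: "T \<in> carrier_mat n n" and "det T \<noteq> 0"
    and contr: "\<And>x. x \<in> carrier_vec n \<Longrightarrow> vec_norm (T *\<^sub>v x) \<le> vec_norm x"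
    and v: "v \<in> carrier_vec n"
  shows "cmod (det T) * vec_norm v \<le> vec_norm (T *\<^sub>v v)"
proof (cases "v = 0\<^sub>v n")
  case True
  then show ?thesis using vec_norm_eq_0_iff[OF v] by simp
next
  case False
  then have pos: "0 < vec_norm v"
    using vec_norm_eq_0_iff[OF v] vec_norm_nonneg[of v] by linarith
  define k where "k = complex_of_real (1 / vec_norm v)"
  have k: "cmod k = 1 / vec_norm v" unfolding k_def by (simp add: norm_divide)
  have Tk: "T *\<^sub>v (k \<cdot>\<^sub>v v) = k \<cdot>\<^sub>v (T *\<^sub>v v)" using T v by (rule mult_mat_vec)
  have "T *\<^sub>v v \<noteq> 0\<^sub>v n"
    using det_0_iff_vec_prod_zero[OF T] assms(2) v False by blast
  then have "0 < vec_norm (T *\<^sub>v v)"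
    using vec_norm_eq_0_iff[of "T *\<^sub>v v" n] T v vec_norm_nonneg[of "T *\<^sub>v v"]
    by (auto simp: less_le)
  then have "cmod (det T) \<le> vec_norm (T *\<^sub>v (k \<cdot>\<^sub>v v))"
    using v pos k by (intro cmod_det_le_norm_unit_image[OF T contr]) (auto simp: Tk vec_norm_smult)
  then show ?thesis using pos by (simp add: Tk vec_norm_smult k field_simps)
qed

lemma the_mat_inverse:
  fixes T :: "complex mat"
  assumes T: "T \<in> carrier_mat n n" and "det T \<noteq> 0"
  shows "the (mat_inverse T) \<in> carrier_mat n n" "T * the (mat_inverse T) = 1\<^sub>m n"
    "the (mat_inverse T) * T = 1\<^sub>m n"
proof -
  obtain B where "mat_inverse T = Some B"
    using mat_inverse(1)[OF T] det_non_zero_imp_unit[OF assms] by fastforce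
  then show "the (mat_inverse T) \<in> carrier_mat n n" "T * the (mat_inverse T) = 1\<^sub>m n"
    "the (mat_inverse T) * T = 1\<^sub>m n"
    using mat_inverse(2)[OF T] by auto
qed

text \<open>The determinant is a product of \<open>n\<close> eigenvalues, each of modulus at least
  \<open>r\<close>.\<close>

lemma r_min_power_le_cmod_det:
  assumes T: "T \<in> carrier_mat n n" and r: "0 < r" "r \<le> r_min T"
  shows "r ^ n \<le> cmod (det T)"
proof -
  obtain as where as: "cmod (det T) = (\<Prod>a\<leftarrow>as. cmod a)" "length as = n"
    "\<And>a. a \<in> set as \<Longrightarrow> eigenvalue T a"
    using cmod_det_eq_prod_eigenvalues[OF T] by metis
  have "finite (spectrum T)" using card_finite_spectrum(1)[OF T] .
  then have "r \<le> cmod a" if "a \<in> set as" for a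
    using that as(3) Min_le[of "cmod ` spectrum T" "cmod a"] r
    by (fastforce simp: r_min_def spectrum_def)
  then have "r ^ length as \<le> (\<Prod>a\<leftarrow>as. cmod a)"
    using r(1) by (induction as) (auto intro!: mult_mono)
  then show ?thesis using as by simp
qed

lemma op_norm_inverse_le:
  assumes T: "T \<in> carrier_mat n n" "op_norm T \<le> 1" and r: "0 < r" "r \<le> r_min T"
  shows "op_norm (the (mat_inverse T)) \<le> 1 / r ^ n"
proof -
  have det: "r ^ n \<le> cmod (det T)" using r_min_power_le_cmod_det T r by blast
  then have nz: "det T \<noteq> 0" using zero_less_power[OF r(1), of n] by auto
  note inv = the_mat_inverse[OF T(1) nz]
  have contr: "vec_norm (T *\<^sub>v x) \<le> vec_norm x" if "x \<in> carrier_vec n" for x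
    using vec_norm_mult_le[OF T(1) that] mult_right_mono[OF T(2), of "vec_norm x"] by simp
  show ?thesis
  proof (rule op_norm_le[OF inv(1)])
    fix x :: "complex vec" assume x: "x \<in> carrier_vec n"
    let ?y = "the (mat_inverse T) *\<^sub>v x"
    have y: "?y \<in> carrier_vec n" using inv(1) x by auto
    have "r ^ n * vec_norm ?y \<le> cmod (det T) * vec_norm ?y"
      using det by (intro mult_right_mono) auto
    also have "\<dots> \<le> vec_norm (T *\<^sub>v ?y)"
      using cmod_det_mult_vec_norm_le[OF T(1) nz contr y] .
    also have "T *\<^sub>v ?y = x"
      using T(1) inv x by (simp add: assoc_mult_mat_vec[symmetric, of _ n n _ n])
    finally show "vec_norm ?y \<le> 1 / r ^ n * vec_norm x"
      using r(1) by (simp add: field_simps)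
  qed (use r in auto)
qed

section \<open>The extremal Toeplitz matrix\<close>

text \<open>The Taylor coefficients of the Blaschke factor \<open>(r - z) / (1 - r z)\<close>.\<close>

definition blaschke_coeff :: "real \<Rightarrow> nat \<Rightarrow> real" where
  "blaschke_coeff r k = (if k = 0 then r else (r\<^sup>2 - 1) * r ^ (k - 1))"

definition blaschke_toeplitz :: "nat \<Rightarrow> real \<Rightarrow> complex mat" where
  "blaschke_toeplitz n r =
     mat n n (\<lambda>(i, j). if j \<le> i then complex_of_real (blaschke_coeff r (i - j)) else 0)"

lemma blaschke_toeplitz_carrier [simp]: "blaschke_toeplitz n r \<in> carrier_mat n n"
  by (simp add: blaschke_toeplitz_def)

lemma blaschke_toeplitz_analytic: "blaschke_toeplitz n r \<in> analytic_toeplitz n"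
  unfolding analytic_toeplitz_def
  by (auto simp: blaschke_toeplitz_def intro!: exI[of _ "\<lambda>k. complex_of_real (blaschke_coeff r k)"])

lemma blaschke_toeplitz_mult_index:
  assumes "x \<in> carrier_vec n" "i < n"
  shows "(blaschke_toeplitz n r *\<^sub>v x) $ i = (\<Sum>j\<le>i. complex_of_real (blaschke_coeff r (i - j)) * x $ j)"
proof -
  have "(blaschke_toeplitz n r *\<^sub>v x) $ i
      = (\<Sum>j<n. if j \<le> i then complex_of_real (blaschke_coeff r (i - j)) * x $ j else 0)"
    using assms unfolding blaschke_toeplitz_def
    by (auto simp: scalar_prod_def lessThan_atLeast0 intro!: sum.cong)
  also have "\<dots> = (\<Sum>j\<le>i. complex_of_real (blaschke_coeff r (i - j)) * x $ j)"
    using assms(2) by (intro sum.mono_neutral_cong_right) auto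
  finally show ?thesis .
qed

text \<open>The matrix is lower triangular with constant diagonal
  \<open>blaschke_coeff r 0 = r\<close>.\<close>

lemma spectrum_blaschke_toeplitz:
  assumes "1 \<le> n"
  shows "spectrum (blaschke_toeplitz n r) = {complex_of_real r}"
proof -
  let ?T = "blaschke_toeplitz n r"
  have "a = r" if "eigenvalue ?T a" for a
  proof -
    have "det (char_matrix ?T a) = 0"
      using that eigenvalue_det[of ?T n a] by simp
    moreover have "det (char_matrix ?T a) = prod_list (diag_mat (char_matrix ?T a))"
      by (rule det_lower_triangular[of n]) (auto simp: char_matrix_def blaschke_toeplitz_def)
    ultimately have "0 \<in> set (diag_mat (char_matrix ?T a))"
      by (simp add: prod_list_zero_iff)
    then show ?thesis
      by (auto simp: diag_mat_def char_matrix_def blaschke_toeplitz_def blaschke_coeff_def)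
  qed
  moreover have "spectrum ?T \<noteq> {}"
    using assms by (intro spectrum_non_empty[of _ n]) auto
  ultimately show ?thesis unfolding spectrum_def by auto
qed

lemma r_min_blaschke_toeplitz: "1 \<le> n \<Longrightarrow> r_min (blaschke_toeplitz n r) = \<bar>r\<bar>"
  by (simp add: r_min_def spectrum_blaschke_toeplitz)

text \<open>With \<open>y = (1 - r S)\<^sup>-\<^sup>1 x\<close>, where \<open>S\<close> is the shift, \<open>x\<^sub>i = y\<^sub>i - r y\<^sub>i\<^sub>-\<^sub>1\<close> and
  \<open>(T x)\<^sub>i = r y\<^sub>i - y\<^sub>i\<^sub>-\<^sub>1\<close>, so that \<open>|x\<^sub>i|\<^sup>2 - |(T x)\<^sub>i|\<^sup>2 = (1 - r\<^sup>2) (|y\<^sub>i|\<^sup>2 - |y\<^sub>i\<^sub>-\<^sub>1|\<^sup>2)\<close> telescopes.\<close>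

lemma blaschke_toeplitz_contraction:
  assumes r: "0 \<le> r" "r \<le> 1" and x: "x \<in> carrier_vec n"
  shows "vec_norm (blaschke_toeplitz n r *\<^sub>v x) \<le> vec_norm x"
proof -
  let ?T = "blaschke_toeplitz n r"
  \<comment> \<open>Indices are shifted by one: the coordinate \<open>y\<^sub>i\<close> of
    \<open>(1 - r S)\<^sup>-\<^sup>1 x\<close> is \<open>y (Suc i)\<close> here, so that
    \<open>y 0 = 0\<close> supplies the missing predecessor and starts the telescoping.\<close>
  define y where "y i = (\<Sum>j<i. complex_of_real (r ^ (i - 1 - j)) * x $ j)" for i
  have y_Suc: "y (Suc i) = x $ i + r * y i" for i
  proof -
    have "y (Suc i) = x $ i + (\<Sum>j<i. complex_of_real (r ^ (i - j)) * x $ j)"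
      unfolding y_def by simp
    also have "(\<Sum>j<i. complex_of_real (r ^ (i - j)) * x $ j) = r * y i"
      unfolding y_def sum_distrib_left
      by (rule sum.cong) (auto simp: mult.assoc[symmetric] power_Suc[symmetric] Suc_diff_Suc
          simp del: power_Suc)
    finally show ?thesis .
  qed
  have Tx: "(?T *\<^sub>v x) $ i = r * y (Suc i) - y i" if "i < n" for i
  proof -
    have "(?T *\<^sub>v x) $ i = (\<Sum>j<i. complex_of_real (blaschke_coeff r (i - j)) * x $ j) + r * x $ i"
      using blaschke_toeplitz_mult_index[OF x that]
      by (simp add: lessThan_Suc_atMost[symmetric] blaschke_coeff_def)
    also have "(\<Sum>j<i. complex_of_real (blaschke_coeff r (i - j)) * x $ j) = (r\<^sup>2 - 1) * y i"
      unfolding y_def sum_distrib_left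
      by (rule sum.cong) (auto simp: blaschke_coeff_def diff_right_commute)
    finally show ?thesis by (simp add: y_Suc power2_eq_square algebra_simps)
  qed
  have "(\<Sum>i<m. (cmod (x $ i))\<^sup>2) - (\<Sum>i<m. (cmod ((?T *\<^sub>v x) $ i))\<^sup>2) = (1 - r\<^sup>2) * (cmod (y m))\<^sup>2"
    if "m \<le> n" for m
    using that
  proof (induction m)
    case 0
    then show ?case by (simp add: y_def)
  next
    case (Suc m)
    have "(cmod (x $ m))\<^sup>2 - (cmod ((?T *\<^sub>v x) $ m))\<^sup>2
        = (1 - r\<^sup>2) * ((cmod (y (Suc m)))\<^sup>2 - (cmod (y m))\<^sup>2)"
      using Suc.prems unfolding Tx[OF Suc_le_lessD[OF Suc.prems]] y_Suc cmod_power2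
      by (simp add: power2_eq_square algebra_simps)
    then show ?case using Suc by (simp add: algebra_simps)
  qed
  from this[of n] have "(vec_norm x)\<^sup>2 - (vec_norm (?T *\<^sub>v x))\<^sup>2 = (1 - r\<^sup>2) * (cmod (y n))\<^sup>2"
    using x by (simp add: vec_norm_power2 blaschke_toeplitz_def)
  moreover have "0 \<le> (1 - r\<^sup>2) * (cmod (y n))\<^sup>2"
    using r by (simp add: power_le_one)
  ultimately have "(vec_norm (?T *\<^sub>v x))\<^sup>2 \<le> (vec_norm x)\<^sup>2" by linarith
  then show ?thesis by (rule power2_le_imp_le) simp
qed

text \<open>The kernel of \<open>1 - T\<^sup>* T\<close> is the hyperplane orthogonal to \<open>(r\<^sup>n\<^sup>-\<^sup>1, \<dots>, r, 1)\<close>, which is therefore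
  a singular vector of \<open>T\<close>, with singular value \<open>|det T| = r\<^sup>n\<close>.\<close>

lemma blaschke_toeplitz_singular_vector:
  "blaschke_toeplitz n r *\<^sub>v vec n (\<lambda>i. complex_of_real (r ^ (n - 1 - i)))
    = complex_of_real (r ^ n) \<cdot>\<^sub>v vec n (\<lambda>i. complex_of_real (r ^ i))"
proof (rule eq_vecI)
  fix i assume "i < dim_vec (complex_of_real (r ^ n) \<cdot>\<^sub>v vec n (\<lambda>i. complex_of_real (r ^ i)))"
  then have i: "i < n" by simp
  \<comment> \<open>The offset \<open>m\<close> stays free for the induction, whose step adds
    \<open>(r\<^sup>2 - 1) * r ^ (m + 1 + 2 * i)\<close>. At \<open>m = n - 1 - i\<close> the
    exponent on the right becomes \<open>n + i\<close>.\<close>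
  have partial: "(\<Sum>k\<le>i. blaschke_coeff r k * r ^ (m + k)) = r ^ (m + 1 + 2 * i)" for m i
  proof (induction i)
    case (Suc i)
    then show ?case
      by (simp add: blaschke_coeff_def power_add power2_eq_square power_mult algebra_simps power_mult_distrib)
  qed (simp add: blaschke_coeff_def)
  have "(\<Sum>j\<le>i. blaschke_coeff r (i - j) * r ^ (n - 1 - j))
      = (\<Sum>k\<le>i. blaschke_coeff r k * r ^ (n - 1 - i + k))"
    using i by (intro sum.reindex_bij_witness[of _ "\<lambda>k. i - k" "\<lambda>j. i - j"]) auto
  also have "\<dots> = r ^ n * r ^ i"
    unfolding partial power_add[symmetric] using i by (intro arg_cong[of _ _ "power r"]) simp
  finally have "(\<Sum>j\<le>i. blaschke_coeff r (i - j) * r ^ (n - 1 - j)) = r ^ n * r ^ i" .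
  from arg_cong[OF this, of complex_of_real]
  show "(blaschke_toeplitz n r *\<^sub>v vec n (\<lambda>i. complex_of_real (r ^ (n - 1 - i)))) $ i
      = (complex_of_real (r ^ n) \<cdot>\<^sub>v vec n (\<lambda>i. complex_of_real (r ^ i))) $ i"
    using i by (subst blaschke_toeplitz_mult_index) auto
qed (simp add: blaschke_toeplitz_def)

text \<open>The inverse sends \<open>r ^ n\<close> times \<open>?u\<close> to \<open>?w\<close>, and
  these two vectors are reversals of each other, hence of equal norm: it stretches by exactly
  \<open>1 / r ^ n\<close>.\<close>

lemma op_norm_inverse_blaschke_toeplitz:
  assumes n: "1 \<le> n" and r: "0 < r"
  shows "1 / r ^ n \<le> op_norm (the (mat_inverse (blaschke_toeplitz n r)))"
proof -
  let ?T = "blaschke_toeplitz n r"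
  let ?w = "vec n (\<lambda>i. complex_of_real (r ^ (n - 1 - i)))" and ?u = "vec n (\<lambda>i. complex_of_real (r ^ i))"
  have "r ^ n \<le> cmod (det ?T)"
    using r by (intro r_min_power_le_cmod_det) (auto simp: r_min_blaschke_toeplitz[OF n])
  then have nz: "det ?T \<noteq> 0"
    using zero_less_power[OF r, of n] by auto
  note inv = the_mat_inverse[OF blaschke_toeplitz_carrier nz]
  have norm_eq: "vec_norm ?w = vec_norm ?u"
  proof -
    have "(\<Sum>i<n. (r ^ (n - 1 - i))\<^sup>2) = (\<Sum>i<n. (r ^ i)\<^sup>2)"
      by (rule sum.reindex_bij_witness[of _ "\<lambda>i. n - 1 - i" "\<lambda>i. n - 1 - i"]) auto
    then have "(vec_norm ?w)\<^sup>2 = (vec_norm ?u)\<^sup>2"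
      using r by (simp add: vec_norm_power2 norm_power)
    then show ?thesis by simp
  qed
  have "vec_norm ?w \<noteq> 0"
  proof
    assume "vec_norm ?w = 0"
    \<comment> \<open>Coordinate 0 exists because \<open>1 \<le> n\<close>, and it equals
      \<open>r ^ (n - 1)\<close>, which is positive.\<close>
    then have "?w = 0\<^sub>v n" using vec_norm_eq_0_iff[of ?w n] by simp
    from arg_cong[OF this, of "\<lambda>v. v $ 0"] show False using n r by simp
  qed
  then have pos: "0 < vec_norm ?w" using vec_norm_nonneg[of ?w] by linarith
  have "the (mat_inverse ?T) *\<^sub>v (?T *\<^sub>v ?w) = ?w"
    using inv by (simp add: assoc_mult_mat_vec[symmetric, of _ n n _ n])
  then have "vec_norm ?w \<le> op_norm (the (mat_inverse ?T)) * vec_norm (?T *\<^sub>v ?w)"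
    using vec_norm_mult_le[OF inv(1), of "?T *\<^sub>v ?w"]
    by (metis blaschke_toeplitz_carrier mult_mat_vec_carrier vec_carrier)
  also have "vec_norm (?T *\<^sub>v ?w) = r ^ n * vec_norm ?w"
    using r unfolding blaschke_toeplitz_singular_vector vec_norm_smult norm_eq
    by (simp add: norm_power)
  finally show ?thesis using pos r by (simp add: field_simps)
qed

section \<open>The exact value of the extremal constants\<close>

lemma t_a_le_c_all: "t_a n r \<le> c_all n r"
  unfolding t_a_def c_all_def c_fam_def
  by (rule SUP_subset_mono) (auto simp: analytic_toeplitz_def)

lemma c_all_le: "0 < r \<Longrightarrow> c_all n r \<le> ereal (1 / r ^ n)"
  unfolding c_all_def c_fam_def using op_norm_inverse_le by (intro SUP_least) auto

lemma t_a_ge: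
  assumes "1 \<le> n" "0 < r" "r \<le> 1"
  shows "ereal (1 / r ^ n) \<le> t_a n r"
proof -
  have "op_norm (blaschke_toeplitz n r) \<le> 1"
    using blaschke_toeplitz_contraction[of r] assms by (intro op_norm_le[of _ n n]) auto
  moreover have "r_min (blaschke_toeplitz n r) = r"
    using assms by (simp add: r_min_blaschke_toeplitz)
  ultimately show ?thesis
    unfolding t_a_def c_fam_def
    using assms blaschke_toeplitz_analytic op_norm_inverse_blaschke_toeplitz[of n r]
    by (intro SUP_upper2[of "blaschke_toeplitz n r"]) auto
qed

text \<open>Both constants are squeezed between \<open>1 / r ^ n\<close> from the Blaschke matrix
  and \<open>1 / r ^ n\<close> from the determinant bound; being finite, they cancel against
  \<open>r ^ n\<close> in \<open>ereal\<close>.\<close>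

lemma power_mult_extremal_constants:
  assumes "1 \<le> n" "0 < r" "r \<le> 1"
  shows "ereal (r ^ n) * t_a n r = 1" "ereal (r ^ n) * c_all n r = 1"
proof -
  have "t_a n r = ereal (1 / r ^ n)" "c_all n r = ereal (1 / r ^ n)"
    using t_a_ge[OF assms] t_a_le_c_all[of n r] c_all_le[OF assms(2), of n] by auto
  then show "ereal (r ^ n) * t_a n r = 1" "ereal (r ^ n) * c_all n r = 1"
    using assms by (simp_all add: one_ereal_def)
qed

theorem mainTheorem1:
  shows "(\<forall>(r::real) (n::nat). 0 < r \<and> r < 1 \<and> 1 \<le> n \<longrightarrow>
            ereal (1 / 2) \<le> ereal (r ^ n) * t_a n r \<and>
            ereal (r ^ n) * t_a n r \<le> ereal (r ^ n) * c_all n r \<and>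
            ereal (r ^ n) * c_all n r = 1) \<and>
         (\<forall>n::nat. 1 \<le> n \<longrightarrow>
            ((\<lambda>r::real. ereal (r ^ n) * t_a n r) \<longlongrightarrow> 1) (at_right 0) \<and>
            ((\<lambda>r::real. ereal (r ^ n) * t_a n r) \<longlongrightarrow> 1) (at_left 1)) \<and>
         (\<forall>r::real. 0 < r \<and> r \<le> 1 \<longrightarrow>
            (\<lambda>n::nat. ereal (r ^ n) * t_a n r) \<longlonglongrightarrow> 1)"
proof (intro conjI allI impI; (elim conjE)?)
  fix r :: real and n :: nat assume r: "0 < r" "r < 1" and n: "1 \<le> n"
  show "ereal (1 / 2) \<le> ereal (r ^ n) * t_a n r"
    "ereal (r ^ n) * t_a n r \<le> ereal (r ^ n) * c_all n r"
    "ereal (r ^ n) * c_all n r = 1"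
    using power_mult_extremal_constants[OF n r(1)] r(2) by (simp_all add: one_ereal_def)
next
  fix n :: nat assume n: "1 \<le> n"
  have "\<forall>\<^sub>F r in at_right 0. ereal (r ^ n) * t_a n r = 1"
    by (rule eventually_at_rightI[of 0 1]) (auto simp: power_mult_extremal_constants[OF n])
  then show "((\<lambda>r::real. ereal (r ^ n) * t_a n r) \<longlongrightarrow> 1) (at_right 0)"
    by (rule tendsto_eventually)
  have "\<forall>\<^sub>F r in at_left 1. ereal (r ^ n) * t_a n r = 1"
    by (rule eventually_at_leftI[of 0 1]) (auto simp: power_mult_extremal_constants[OF n])
  then show "((\<lambda>r::real. ereal (r ^ n) * t_a n r) \<longlongrightarrow> 1) (at_left 1)"
    by (rule tendsto_eventually)
next
  fix r :: real assume "0 < r" "r \<le> 1"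
  \<comment> \<open>The value is known from \<open>n = 1\<close> on, where \<open>r_min\<close> is
    meaningful.\<close>
  then have "\<forall>\<^sub>F n in sequentially. ereal (r ^ n) * t_a n r = 1"
    by (intro eventually_mono[OF eventually_ge_at_top[of 1]] power_mult_extremal_constants)
  then show "(\<lambda>n::nat. ereal (r ^ n) * t_a n r) \<longlonglongrightarrow> 1"
    by (rule tendsto_eventually)
qed

end
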